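(* For a non-negative integer $v$ let $\vartheta(v)=4l$ if $v\in\{4l+2,4l+3\}$ and $\vartheta(v)=4l-3$ if $v\in\{4l,4l+1\}$. Let $v,k$ be integers with $v\geq 6$ and $4\leq k\leq\vartheta(v)$. Then for every pair of graphs $G,G'$ on the same set $V$ of $v$ vertices, the following are equivalent: (i) $G$ and $G'$ are $k$-hypomorphic up to complementation; (ii) for every $k$-element subset $K$ of $V$, $e(G'_{\restriction K})\in\{e(G_{\restriction K}),e(\overline G_{\restriction K})\}$ and $h^{(3)}(G_{\restriction K})=h^{(3)}(G'_{\restriction K})$; (iii) there is an integer $k'$ with $3\leq k'<k$ such that for every subset $K$ of $V$ with $|K|\in\{k,k'\}$, $e(G'_{\restriction K})\in\{e(G_{\restriction K}),e(\overline G_{\restriction K})\}$; (iv) $G'=G$ or $G'=\overline G$.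
   Context: A graph is a pair $G=(V,E)$ with $E$ a set of 2-element subsets of $V$; $\overline G$ is its complement, $G_{\restriction K}$ the subgraph induced on $K$, and $e(H)$ the number of edges of $H$. Two graphs are isomorphic up to complementation if one is isomorphic to the other or to its complement; $G,G'$ on $V$ are $k$-hypomorphic up to complementation if $G_{\restriction K}$ and $G'_{\restriction K}$ are isomorphic up to complementation for every $k$-element $K\subseteq V$. A $3$-homogeneous subset of $G$ is a 3-element subset of $V$ all of whose pairs are edges of $G$, or all of whose pairs are non-edges of $G$; $h^{(3)}(G)$ denotes the number of $3$-homogeneous subsets of $G$. *)

theory Defs
  imports Complex_Main "HOL-Library.Ramsey"
begin

type_synonym 'a graph = "'a set \<times> 'a set set"

abbreviation verts :: "'a graph \<Rightarrow> 'a set" where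
  "verts G \<equiv> fst G"

abbreviation edges :: "'a graph \<Rightarrow> 'a set set" where
  "edges G \<equiv> snd G"

(* nsets A k, displayed with brackets and exponent, is the set of k-element subsets of A. *)
definition is_graph :: "'a graph \<Rightarrow> bool" where
  "is_graph G \<longleftrightarrow> edges G \<subseteq> nsets (verts G) 2"

definition compl_graph :: "'a graph \<Rightarrow> 'a graph" where
  "compl_graph G = (verts G, nsets (verts G) 2 - edges G)"

definition induced :: "'a graph \<Rightarrow> 'a set \<Rightarrow> 'a graph" where
  "induced G K = (K, {e \<in> edges G. e \<subseteq> K})"

definition num_edges :: "'a graph \<Rightarrow> nat" where
  "num_edges G = card (edges G)"

definition isomorphic :: "'a graph \<Rightarrow> 'a graph \<Rightarrow> bool" where
  "isomorphic G H \<longleftrightarrow>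
     (\<exists>f. bij_betw f (verts G) (verts H) \<and>
          (\<forall>x\<in>verts G. \<forall>y\<in>verts G. {x, y} \<in> edges G \<longleftrightarrow> {f x, f y} \<in> edges H))"

definition iso_upto_compl :: "'a graph \<Rightarrow> 'a graph \<Rightarrow> bool" where
  "iso_upto_compl G H \<longleftrightarrow> isomorphic G H \<or> isomorphic G (compl_graph H)"

(* Meant for graphs G, G' that both have vertex set V. *)
definition hypomorphic_upto_compl ::
    "nat \<Rightarrow> 'a set \<Rightarrow> 'a graph \<Rightarrow> 'a graph \<Rightarrow> bool" where
  "hypomorphic_upto_compl k V G G' \<longleftrightarrow>
     (\<forall>K \<in> nsets V k. iso_upto_compl (induced G K) (induced G' K))"

definition homogeneous3 :: "'a graph \<Rightarrow> 'a set set" where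
  "homogeneous3 G =
     {T \<in> nsets (verts G) 3. nsets T 2 \<subseteq> edges G \<or> nsets T 2 \<inter> edges G = {}}"

definition h3 :: "'a graph \<Rightarrow> nat" where
  "h3 G = card (homogeneous3 G)"

(* Here l = v div 4. The value is -3 for v = 0 and v = 1, hence the integer type. *)
definition vartheta :: "nat \<Rightarrow> int" where
  "vartheta v =
     (if v mod 4 \<in> {2, 3} then 4 * int (v div 4) else 4 * int (v div 4) - 3)"

end

theory Submission
  imports Defs
begin

text \<open>
  The conditions (ii) and (iii) constrain \<open>U = E \<triangle> E'\<close>, the symmetric difference of the edge
  sets. Give edges the sign 1 and non-edges the sign -1. Then
  \<open>e(G'|K) \<in> {e(G|K), e(complement of G|K)}\<close> says that the two squared sign sums over the pairs
  in \<open>K\<close> agree. Grouping the products in such a square by the union of the two pairs turns the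
  difference of the squares into a sum over the 3-subsets of \<open>K\<close>, which equals 8 times the
  difference of the numbers of homogeneous triples, plus a sum over the 4-subsets of \<open>K\<close>. Averaging
  over \<open>k'\<close>-subsets scales these two sums by different factors, so (iii) makes both vanish and
  implies (ii).

  Under (ii), if 4 divides \<open>k\<close> then every \<open>k\<close>-set contains an even number of elements of \<open>U\<close>, and
  swapping vertices in and out shows that \<open>U\<close> is empty or complete. Otherwise \<open>k \<le> v - 3\<close>, and by
  the injectivity of inclusion matrices \<open>G\<close> and \<open>G'\<close> have the same homogeneous triples. The term of
  a 4-set \<open>Q\<close> is then 4 times an integer congruent mod 2 to the number of \<open>U\<close>-pairs in \<open>Q\<close>. If
  \<open>k \<le> v - 4\<close>, all these terms vanish and the parity argument applies with 4 in place of \<open>k\<close>. The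
  only other case is \<open>k = v - 3\<close> with \<open>v\<close> even; there the terms of the 4-sets containing a given triple
  still sum to 0, which forces all triples to contain the same parity of \<open>U\<close>-pairs. Together with
  the equality of homogeneous triples this again makes \<open>U\<close> empty or complete.
\<close>

section \<open>Sums over k-subsets and inclusion matrices\<close>

lemma nsets_card_self:
  assumes "finite A" "card A = n"
  shows "nsets A n = {A}"
  using assms card_subset_eq[of A] by (auto simp: nsets_def)

text \<open>Removing \<open>Q\<close> leaves an arbitrary \<open>(k - t)\<close>-subset of
  \<open>L - Q\<close>. For \<open>t > k\<close> truncated subtraction would make the binomial
  coefficient 1, hence the case distinction.\<close>

lemma card_nsets_supersets:
  assumes "finite L" "Q \<in> nsets L t"
  shows "card {K \<in> nsets L k. Q \<subseteq> K} = (if t \<le> k then (card L - t) choose (k - t) else 0)"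
proof (cases "t \<le> k")
  case True
  have Q: "Q \<subseteq> L" "finite Q" "card Q = t"
    using assms by (auto simp: nsets_def)
  have "bij_betw (\<lambda>R. R \<union> Q) (nsets (L - Q) (k - t)) {K \<in> nsets L k. Q \<subseteq> K}"
  proof (rule bij_betwI[where g = "\<lambda>K. K - Q"])
    show "(\<lambda>R. R \<union> Q) \<in> nsets (L - Q) (k - t) \<rightarrow> {K \<in> nsets L k. Q \<subseteq> K}"
    proof
      fix R assume "R \<in> nsets (L - Q) (k - t)"
      then have R: "R \<subseteq> L - Q" "finite R" "card R = k - t" by (auto simp: nsets_def)
      then have "card (R \<union> Q) = card R + card Q"
        using Q by (intro card_Un_disjoint) auto
      then show "R \<union> Q \<in> {K \<in> nsets L k. Q \<subseteq> K}"
        using R Q True by (auto simp: nsets_def)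
    qed
    show "(\<lambda>K. K - Q) \<in> {K \<in> nsets L k. Q \<subseteq> K} \<rightarrow> nsets (L - Q) (k - t)"
      using Q by (auto simp: nsets_def card_Diff_subset)
  qed (auto simp: nsets_def)
  then have "card {K \<in> nsets L k. Q \<subseteq> K} = card (nsets (L - Q) (k - t))"
    by (rule bij_betw_same_card[symmetric])
  also have "\<dots> = (card L - t) choose (k - t)"
    using Q by (simp add: card_nsets card_Diff_subset)
  finally show ?thesis using True by simp
next
  case False
  have "{K \<in> nsets L k. Q \<subseteq> K} = {}"
    using False assms by (auto simp: nsets_def dest: card_mono)
  then show ?thesis using False by (simp only: card.empty if_False)
qed

text \<open>Double counting: every \<open>t\<close>-subset of \<open>L\<close> lies in equally many
  \<open>k\<close>-subsets. That this number depends on \<open>t\<close> later separates triples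
  from 4-sets.\<close>

lemma sum_nsets_nsets:
  fixes f :: "'a set \<Rightarrow> 'b::comm_semiring_1"
  assumes "finite L" "t \<le> k"
  shows "(\<Sum>K\<in>nsets L k. sum f (nsets K t)) = of_nat ((card L - t) choose (k - t)) * sum f (nsets L t)"
proof -
  have "(\<Sum>K\<in>nsets L k. sum f (nsets K t)) = (\<Sum>K\<in>nsets L k. sum f {Q \<in> nsets L t. Q \<subseteq> K})"
    by (intro sum.cong refl arg_cong[where f = "sum f"]) (auto simp: nsets_def)
  also have "\<dots> = (\<Sum>Q\<in>nsets L t. \<Sum>K | K \<in> nsets L k \<and> Q \<subseteq> K. f Q)"
    by (rule sum.swap_restrict) (use assms in \<open>auto intro: finite_imp_finite_nsets\<close>)
  also have "\<dots> = (\<Sum>Q\<in>nsets L t. of_nat ((card L - t) choose (k - t)) * f Q)"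
    using assms by (intro sum.cong refl) (simp add: card_nsets_supersets)
  finally show ?thesis by (simp add: sum_distrib_left)
qed

text \<open>The case \<open>card S = t\<close> is the full row rank of inclusion matrices (Gottlieb, Kantor).\<close>
lemma sum_supersets_eq_0:
  fixes f :: "'a set \<Rightarrow> int"
  assumes "finite S" "finite V" "S \<subseteq> V" "k + card S \<le> card V" "t \<le> k"
    and "\<And>K. K \<in> nsets V k \<Longrightarrow> sum f (nsets K t) = 0"
  shows "sum f {Q \<in> nsets V t. S \<subseteq> Q} = 0"
  using assms
proof (induction S arbitrary: V rule: finite_induct)
  case empty
  have "of_nat ((card V - t) choose (k - t)) * sum f (nsets V t) = 0"
    using sum_nsets_nsets[of V t k f] empty by simp
  moreover have "(card V - t) choose (k - t) \<noteq> 0"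
    using empty by simp
  ultimately show ?case by simp
next
  case (insert x S)
  \<comment> \<open>The sets \<open>Q\<close> over \<open>S\<close> that avoid \<open>x\<close> live
    in \<open>V - {x}\<close>. The induction hypothesis applies there too: in
    \<open>k + card S \<le> card V\<close> the smaller \<open>S\<close> makes up for the lost
    vertex.\<close>
  have "sum f {Q \<in> nsets V t. S \<subseteq> Q} = 0"
    using insert by (intro insert.IH) auto
  moreover have "sum f {Q \<in> nsets (V - {x}) t. S \<subseteq> Q} = 0"
    using insert.prems insert.hyps by (intro insert.IH) (auto simp: nsets_def)
  moreover have "{Q \<in> nsets V t. S \<subseteq> Q} = 
      {Q \<in> nsets V t. insert x S \<subseteq> Q} \<union> {Q \<in> nsets (V - {x}) t. S \<subseteq> Q}"
    by (auto simp: nsets_def)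
  moreover have "sum f ({Q \<in> nsets V t. insert x S \<subseteq> Q} \<union> {Q \<in> nsets (V - {x}) t. S \<subseteq> Q}) =
      sum f {Q \<in> nsets V t. insert x S \<subseteq> Q} + sum f {Q \<in> nsets (V - {x}) t. S \<subseteq> Q}"
    using insert.prems
    by (intro sum.union_disjoint) (auto simp: nsets_def intro: finite_subset[of _ "Pow V"])
  ultimately show ?case by simp
qed

lemma eq_0_if_nsets_sums_eq_0:
  fixes f :: "'a set \<Rightarrow> int"
  assumes "finite V" "k + t \<le> card V" "t \<le> k" "S \<in> nsets V t"
    and "\<And>K. K \<in> nsets V k \<Longrightarrow> sum f (nsets K t) = 0"
  shows "f S = 0"
proof -
  have "{Q \<in> nsets V t. S \<subseteq> Q} = {S}"
    using assms(4) by (auto simp: nsets_def dest: card_subset_eq)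
  moreover have "sum f {Q \<in> nsets V t. S \<subseteq> Q} = 0"
    using assms by (intro sum_supersets_eq_0) (auto simp: nsets_def)
  ultimately show ?thesis by simp
qed

section \<open>Squares of sums over pairs\<close>

definition pair_sum :: "('a set \<Rightarrow> int) \<Rightarrow> 'a set \<Rightarrow> int" where
  "pair_sum w K = sum w (nsets K 2)"

text \<open>The contribution of \<open>S\<close> to the expansion of a square: on a 3-set the
  products of two pairs sharing a vertex, on a 4-set those of two disjoint pairs, each counted in
  both orders.\<close>

definition cover_sum :: "('a set \<Rightarrow> int) \<Rightarrow> 'a set \<Rightarrow> int" where
  "cover_sum w S =
     (\<Sum>p | p \<in> nsets S 2 \<times> nsets S 2 \<and> fst p \<union> snd p = S. w (fst p) * w (snd p))"

lemma pair_sum_square: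
  assumes "finite K"
  shows "(pair_sum w K)\<^sup>2 = (\<Sum>e\<in>nsets K 2. (w e)\<^sup>2) +
    sum (cover_sum w) (nsets K 3) + sum (cover_sum w) (nsets K 4)"
proof -
  let ?P = "nsets K 2 \<times> nsets K 2" and ?B = "nsets K 2 \<union> nsets K 3 \<union> nsets K 4"
  have fin: "finite (nsets K n)" for n using assms by (rule finite_imp_finite_nsets)
  have "(pair_sum w K)\<^sup>2 = (\<Sum>p\<in>?P. w (fst p) * w (snd p))"
    by (simp add: pair_sum_def power2_eq_square sum_product sum.cartesian_product case_prod_beta)
  also have "\<dots> = (\<Sum>S\<in>?B. \<Sum>p | p \<in> ?P \<and> fst p \<union> snd p = S. w (fst p) * w (snd p))"
  proof (rule sum.group[symmetric])
    show "(\<lambda>p. fst p \<union> snd p) ` ?P \<subseteq> ?B"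
    proof (rule image_subsetI)
      fix p assume p: "p \<in> ?P"
      then have "card (fst p \<union> snd p) \<le> 4"
        using card_Un_le[of "fst p" "snd p"] by (auto simp: nsets_def)
      moreover have "2 \<le> card (fst p \<union> snd p)"
        using p card_mono[of "fst p \<union> snd p" "fst p"] by (auto simp: nsets_def)
      ultimately have "card (fst p \<union> snd p) \<in> {2, 3, 4}" by auto
      then show "fst p \<union> snd p \<in> ?B" using p by (auto simp: nsets_def)
    qed
  qed (use fin in auto)
  \<comment> \<open>Pairs in \<open>K\<close> whose union is \<open>S\<close> are pairs in
    \<open>S\<close>, so each inner sum depends on \<open>S\<close> alone.\<close>
  also have "\<dots> = sum (cover_sum w) ?B"
    unfolding cover_sum_def
    by (intro sum.cong refl arg_cong[where f = "sum _"]) (auto simp: nsets_def)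
  also have "\<dots> = sum (cover_sum w) (nsets K 2) + sum (cover_sum w) (nsets K 3) + sum (cover_sum w) (nsets K 4)"
    using fin by (subst sum.union_disjoint; (subst sum.union_disjoint)?) (auto simp: nsets_def)
  also have "sum (cover_sum w) (nsets K 2) = (\<Sum>e\<in>nsets K 2. (w e)\<^sup>2)"
  proof (rule sum.cong[OF refl])
    fix e assume "e \<in> nsets K 2"
    then have "nsets e 2 = {e}"
      by (intro nsets_card_self) (auto simp: nsets_def)
    then have "{p \<in> nsets e 2 \<times> nsets e 2. fst p \<union> snd p = e} = {(e, e)}"
      by auto
    then show "cover_sum w e = (w e)\<^sup>2" by (simp add: cover_sum_def power2_eq_square)
  qed
  finally show ?thesis .
qed

lemma pair_sum_insert:
  assumes "finite K" "x \<notin> K"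
  shows "pair_sum w (insert x K) = pair_sum w K + (\<Sum>y\<in>K. w {x, y})"
proof -
  have "nsets (insert x K) 2 = nsets K 2 \<union> (\<lambda>y. {x, y}) ` K"
    using assms(2) by (auto simp: nsets_2_eq)
  moreover have "nsets K 2 \<inter> (\<lambda>y. {x, y}) ` K = {}"
    using assms(2) by (auto simp: nsets_def)
  moreover have "inj_on (\<lambda>y. {x, y}) K"
    by (auto simp: inj_on_def doubleton_eq_iff)
  ultimately show ?thesis
    using assms by (simp add: pair_sum_def sum.union_disjoint finite_imp_finite_nsets sum.reindex)
qed

lemma pair_sum_triple:
  assumes "x \<noteq> y" "y \<noteq> z" "x \<noteq> z"
  shows "pair_sum w {x, y, z} = w {x, y} + w {x, z} + w {y, z}"
proof -
  have "pair_sum w {z} = 0"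
    by (simp add: pair_sum_def nsets_singleton_iff)
  then show ?thesis
    using assms by (simp add: pair_sum_insert)
qed

section \<open>Parity and exchange of vertices\<close>

text \<open>Exchanging one element of an \<open>m\<close>-set shows that all values of
  \<open>f\<close> on \<open>W\<close> have the same parity; \<open>m < card W\<close> leaves room
  for this. A sum over an \<open>m\<close>-set is then congruent to \<open>m * f x\<close>, with
  \<open>m\<close> odd.\<close>

lemma even_if_odd_nsets_sums_even:
  fixes f :: "'a \<Rightarrow> int"
  assumes "finite W" "odd m" "m < card W" "x \<in> W"
    and ev: "\<And>K. K \<in> nsets W m \<Longrightarrow> even (sum f K)"
  shows "even (f x)"
proof -
  have "m - 1 \<le> card (W - {x})"
    using assms by simp
  have par: "even (f y) \<longleftrightarrow> even (f x)" if "y \<in> W" for y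
  proof (cases "y = x")
    case False
    have "m - 1 \<le> card (W - {x, y})"
      using assms False that by (simp add: card_Diff_subset)
    then obtain L where L: "L \<subseteq> W - {x, y}" "card L = m - 1" "finite L"
      by (meson obtain_subset_with_card_n)
    then have "even (sum f (insert x L))" "even (sum f (insert y L))"
      using assms that by (auto intro!: ev simp: nsets_def card_insert_if odd_pos)
    moreover have "x \<notin> L" "y \<notin> L" using L by auto
    ultimately show ?thesis using L by simp
  qed simp
  obtain K where K: "K \<subseteq> W" "card K = m" "finite K"
    using assms by (meson less_imp_le obtain_subset_with_card_n)
  have "even (sum f K)" using ev K by (simp add: nsets_def)
  moreover have "even (sum f K) \<longleftrightarrow> even (of_nat (card K) * f x)"
    using K(3,1)
  proof (induction K rule: finite_induct)
    case (insert y K)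
    then show ?case using par[of y] by (auto simp: algebra_simps)
  qed simp
  ultimately show ?thesis
    using K assms(2) by simp
qed

text \<open>Exchanging \<open>x\<close> for \<open>y\<close> in a \<open>k\<close>-set changes the
  pair sum by a sum over the \<open>k - 1\<close> other vertices. As \<open>k - 1\<close> is odd,
  the previous lemma makes each summand even, so membership in \<open>U\<close> survives replacing
  one end of a pair.\<close>

lemma constant_if_even_pair_sums:
  fixes U :: "'a set set"
  assumes "finite V" "even k" "4 \<le> k" "k + 2 \<le> card V"
    and ev: "\<And>K. K \<in> nsets V k \<Longrightarrow> even (pair_sum (\<lambda>e. of_bool (e \<in> U)) K)"
  shows "nsets V 2 \<subseteq> U \<or> nsets V 2 \<inter> U = {}"
proof -
  define u :: "'a set \<Rightarrow> int" where "u = (\<lambda>e. of_bool (e \<in> U))"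
  have swap: "{x, z} \<in> U \<longleftrightarrow> {y, z} \<in> U"
    if xyz: "x \<in> V" "y \<in> V" "z \<in> V" "x \<noteq> y" "x \<noteq> z" "y \<noteq> z" for x y z
  proof -
    have "even (u {x, z} - u {y, z})"
    proof (rule even_if_odd_nsets_sums_even[where W = "V - {x, y}" and m = "k - 1"])
      fix K assume "K \<in> nsets (V - {x, y}) (k - 1)"
      then have K: "finite K" "x \<notin> K" "y \<notin> K" "K \<subseteq> V" "card K = k - 1"
        by (auto simp: nsets_def)
      then have "even (pair_sum u (insert x K))" "even (pair_sum u (insert y K))"
        using xyz assms by (auto intro!: ev simp: u_def nsets_def card_insert_if)
      then have "even (pair_sum u (insert x K) - pair_sum u (insert y K))"
        by simp
      then show "even (\<Sum>z\<in>K. u {x, z} - u {y, z})"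
        using K by (simp add: pair_sum_insert sum_subtractf)
    qed (use assms xyz in \<open>auto simp: card_Diff_subset\<close>)
    then show ?thesis
      by (cases "{x, z} \<in> U"; cases "{y, z} \<in> U"; simp add: u_def)
  qed
  \<comment> \<open>First \<open>a\<close> is replaced by \<open>c\<close>, then \<open>b\<close> by
    \<open>d\<close>; the cases avoid degenerate pairs.\<close>
  have "{c, d} \<in> U" if "{a, b} \<in> U" "{a, b} \<in> nsets V 2" "{c, d} \<in> nsets V 2" for a b c d
  proof (cases "c = b")
    case True
    then show ?thesis
      using that swap[of a d b] by (cases "a = d") (auto simp: insert_commute)
  next
    case False
    then have "{c, b} \<in> U"
      using that swap[of a c b] by (cases "a = c") auto
    then show ?thesis using that False swap[of b d c] by (cases "b = d") (auto simp: insert_commute)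
  qed
  then show ?thesis
    by (smt (verit) disjoint_iff nsets2_E subsetI)
qed

section \<open>Homogeneous triples and triples of equal parity\<close>

text \<open>Stated for an arbitrary set \<open>E\<close>, so that \<open>- E'\<close> can later
  stand for the complementary graph.\<close>

definition homog :: "'a set set \<Rightarrow> 'a set \<Rightarrow> bool" where
  "homog E T \<longleftrightarrow> nsets T 2 \<subseteq> E \<or> nsets T 2 \<inter> E = {}"

lemma homog_triple:
  assumes "x \<noteq> y" "y \<noteq> z" "x \<noteq> z"
  shows "homog E {x, y, z} \<longleftrightarrow>
    ({x, y} \<in> E \<longleftrightarrow> {x, z} \<in> E) \<and> ({x, y} \<in> E \<longleftrightarrow> {y, z} \<in> E)"
proof -
  have "nsets {x, y, z} 2 = {{x, y}, {x, z}, {y, z}}"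
    using assms by (auto simp: nsets_2_eq)
  then show ?thesis unfolding homog_def by auto
qed

definition sdiff_sum :: "'a set set \<Rightarrow> 'a set set \<Rightarrow> 'a set \<Rightarrow> int" where
  "sdiff_sum E E' = pair_sum (\<lambda>e. of_bool (e \<in> E \<longleftrightarrow> e \<notin> E'))"

lemma nsets3_E:
  assumes "T \<in> nsets V 3"
  obtains x y z where "T = {x, y, z}" "x \<in> V" "y \<in> V" "z \<in> V" "x \<noteq> y" "y \<noteq> z" "x \<noteq> z"
  using assms by (auto simp: nsets_3_eq)

text \<open>A chain of three equivalences is true iff an odd number of its members are. Each member
  says that a pair lies outside the symmetric difference.\<close>

lemma sdiff_sum_triple:
  assumes "x \<noteq> y" "y \<noteq> z" "x \<noteq> z"
  shows "even (sdiff_sum E E' {x, y, z}) \<longleftrightarrow>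
    (({x, y} \<in> E \<longleftrightarrow> {x, y} \<in> E') \<longleftrightarrow> (({x, z} \<in> E \<longleftrightarrow> {x, z} \<in> E') \<longleftrightarrow> ({y, z} \<in> E \<longleftrightarrow> {y, z} \<in> E')))"
  using assms by (auto simp: sdiff_sum_def pair_sum_triple)

text \<open>
  Two adjacent \<open>U\<close>-edges \<open>ab\<close>, \<open>ac\<close> must have opposite signs in \<open>G\<close>, because \<open>bc \<notin> U\<close> and \<open>abc\<close> would
  otherwise be homogeneous in exactly one of the two graphs. So \<open>U\<close>-degrees are at most 2, whereas
  the neighbourhoods of the ends of a \<open>U\<close>-edge cover \<open>V\<close>.
\<close>
lemma eq_if_even_triples:
  assumes "5 \<le> card V"
    and ev: "\<And>T. T \<in> nsets V 3 \<Longrightarrow> even (sdiff_sum E E' T)"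
    and hom: "\<And>T. T \<in> nsets V 3 \<Longrightarrow> homog E T \<longleftrightarrow> homog E' T"
    and e: "e \<in> nsets V 2"
  shows "e \<in> E \<longleftrightarrow> e \<in> E'"
proof (rule ccontr)
  assume neq: "\<not> (e \<in> E \<longleftrightarrow> e \<in> E')"
  have fin: "finite V" using assms(1) by (intro card_ge_0_finite) simp
  \<comment> \<open>\<open>s\<close> is non-adjacency in the graph with edge set \<open>U\<close>;
    \<open>B\<close> below gives the neighbourhoods in that graph.\<close>
  define s where "s = (\<lambda>x y. {x, y} \<in> E \<longleftrightarrow> {x, y} \<in> E')"
  have s_commute: "s x y = s y x" for x y by (simp add: s_def insert_commute)
  obtain x y where xy: "e = {x, y}" "x \<in> V" "y \<in> V" "x \<noteq> y"
    using e by (elim nsets2_E) auto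
  define B where "B x = {z \<in> V - {x}. \<not> s x z}" for x
  have tri: "s a b \<longleftrightarrow> (s a c \<longleftrightarrow> s b c)" if "a \<in> V" "b \<in> V" "c \<in> V" "a \<noteq> b" "b \<noteq> c" "a \<noteq> c" for a b c
    using ev[of "{a, b, c}"] that sdiff_sum_triple[of a b c] by (simp add: s_def nsets_def)
  have alt: "{a, b} \<in> E \<longleftrightarrow> {a, c} \<notin> E" 
    if "a \<in> V" "b \<in> B a" "c \<in> B a" "b \<noteq> c" for a b c
  proof -
    have mem: "b \<in> V" "c \<in> V" "a \<noteq> b" "a \<noteq> c" "\<not> s a b" "\<not> s a c"
      using that by (auto simp: B_def)
    then have "s b c" using tri[of a b c] that by blast
    moreover have "homog E {a, b, c} \<longleftrightarrow> homog E' {a, b, c}"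
      using mem that by (intro hom) (simp add: nsets_def)
    ultimately show ?thesis
      using mem(5,6) homog_triple[OF mem(3) \<open>b \<noteq> c\<close> mem(4)] unfolding s_def by blast
  qed
  have small: "card (B a) \<le> 2" if "a \<in> V" for a
  proof (rule ccontr)
    assume "\<not> card (B a) \<le> 2"
    then have "3 \<le> card (B a)" by simp
    then obtain C where "C \<subseteq> B a" "card C = 3" by (meson obtain_subset_with_card_n)
    then obtain b c d where "{b, c, d} \<subseteq> B a" "b \<noteq> c" "c \<noteq> d" "b \<noteq> d"
      by (auto simp: card_3_iff)
    \<comment> \<open>Of three \<open>U\<close>-edges at \<open>a\<close>, two have the same
      sign.\<close>
    then show False using alt[of a b c] alt[of a b d] alt[of a c d] that by auto
  qed
  \<comment> \<open>A triple containing the \<open>U\<close>-pair \<open>xy\<close> has exactly one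
    further \<open>U\<close>-pair, \<open>xz\<close> or \<open>yz\<close>.\<close>
  have "V \<subseteq> B x \<union> B y"
  proof
    fix z assume "z \<in> V"
    then show "z \<in> B x \<union> B y"
      using neq xy tri[of x y z] s_commute[of x y]
      by (cases "z = x \<or> z = y") (auto simp: B_def s_def insert_commute)
  qed
  then have "card V \<le> card (B x \<union> B y)" using fin by (intro card_mono) (auto simp: B_def)
  also have "\<dots> \<le> card (B x) + card (B y)" by (rule card_Un_le)
  finally show False using small[of x] small[of y] xy assms(1) by simp
qed

text \<open>
  With \<open>d\<close> the degree, the hypothesis reads \<open>pair_sum u {x, y, z} \<equiv> d x + d y + d z\<close> mod 2; adding
  this up over the triples of a 4-set shows that \<open>d\<close> is constant mod 2.
\<close>
lemma equal_parity_triples: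
  fixes u :: "'a set \<Rightarrow> int"
  assumes "finite V" "even (card V)" "5 \<le> card V"
    and ev: "\<And>T. T \<in> nsets V 3 \<Longrightarrow> even (\<Sum>r\<in>V - T. pair_sum u (insert r T))"
  shows "(\<forall>T\<in>nsets V 3. even (pair_sum u T)) \<or> (\<forall>T\<in>nsets V 3. odd (pair_sum u T))"
proof -
  define d where "d x = (\<Sum>r\<in>V - {x}. u {x, r})" for x
  have deg: "even (u {x, y} + u {x, z} + u {y, z} + d x + d y + d z)"
    if xyz: "{x, y, z} \<subseteq> V" "x \<noteq> y" "y \<noteq> z" "x \<noteq> z" for x y z
  proof -
    let ?T = "{x, y, z}"
    have part: "d a = (\<Sum>r\<in>V - ?T. u {a, r}) + (\<Sum>r\<in>?T - {a}. u {a, r})" if "a \<in> ?T" for a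
    proof -
      have "V - {a} = (V - ?T) \<union> (?T - {a})" using that xyz by auto
      then show ?thesis unfolding d_def using assms(1) by (simp only:) (rule sum.union_disjoint, auto)
    qed
    define X where "X = (\<Sum>r\<in>V - ?T. u {x, r}) + (\<Sum>r\<in>V - ?T. u {y, r}) + (\<Sum>r\<in>V - ?T. u {z, r})"
    have "(\<Sum>r\<in>V - ?T. pair_sum u (insert r ?T)) =
        (\<Sum>r\<in>V - ?T. pair_sum u ?T + (u {x, r} + u {y, r} + u {z, r}))"
      using xyz by (intro sum.cong refl) (simp add: pair_sum_insert insert_commute)
    also have "\<dots> = of_nat (card (V - ?T)) * pair_sum u ?T + X"
      by (simp add: X_def sum.distrib)
    finally have "even (of_nat (card (V - ?T)) * pair_sum u ?T + X)"
      using ev[of ?T] xyz by (simp add: nsets_def)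
    moreover have "odd (card (V - ?T))"
      using xyz assms by (simp add: card_Diff_subset)
    ultimately have "even (pair_sum u ?T + X)"
      by simp
    \<comment> \<open>Each pair inside the triple is counted from both of its ends.\<close>
    moreover have "d x + d y + d z = X + 2 * (u {x, y} + u {x, z} + u {y, z})"
      using part[of x] part[of y] part[of z] xyz by (simp add: X_def insert_commute insert_Diff_if)
    then have "u {x, y} + u {x, z} + u {y, z} + d x + d y + d z =
        (pair_sum u ?T + X) + 2 * (u {x, y} + u {x, z} + u {y, z})"
      using xyz by (simp add: pair_sum_triple)
    ultimately show ?thesis by (metis dvd_add dvd_triv_left)
  qed
  have four: "even (d x + d y + d z + d w)" if "{x, y, z, w} \<subseteq> V" "card {x, y, z, w} = 4" for x y z w
  proof -
    have "x \<noteq> y" "x \<noteq> z" "x \<noteq> w" "y \<noteq> z" "y \<noteq> w" "z \<noteq> w"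
      using that(2) by (auto simp: card_insert_if split: if_splits)
    \<comment> \<open>Over the four triples each pair occurs twice and each degree three
      times.\<close>
    then have "even ((u {x, y} + u {x, z} + u {y, z} + d x + d y + d z) +
        (u {x, y} + u {x, w} + u {y, w} + d x + d y + d w) +
        (u {x, z} + u {x, w} + u {z, w} + d x + d z + d w) +
        (u {y, z} + u {y, w} + u {z, w} + d y + d z + d w))" (is "even ?s")
      using that(1) by (intro dvd_add[OF dvd_add[OF dvd_add]] deg) auto
    moreover have "d x + d y + d z + d w = ?s - 2 * (u {x, y} + u {x, z} + u {y, z} +
        u {x, w} + u {y, w} + u {z, w} + d x + d y + d z + d w)"
      by simp
    ultimately show ?thesis by (metis dvd_diff dvd_triv_left)
  qed
  have const: "even (d x + d y)" if "x \<in> V" "y \<in> V" for x y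
  proof (cases "x = y")
    case False
    have "3 \<le> card (V - {x, y})" using assms that False by (simp add: card_Diff_subset)
    then obtain C where "C \<subseteq> V - {x, y}" "card C = 3" by (meson obtain_subset_with_card_n)
    then obtain a b c where "{a, b, c} \<subseteq> V - {x, y}" "a \<noteq> b" "b \<noteq> c" "a \<noteq> c"
      by (auto simp: card_3_iff)
    then have "even (d x + d a + d b + d c)" "even (d y + d a + d b + d c)"
      using four[of x a b c] four[of y a b c] that by auto
    then show ?thesis by simp presburger
  qed simp
  \<comment> \<open>All degrees being congruent to \<open>d p\<close>, each triple has pair sum
    congruent to \<open>3 * d p\<close>, hence to \<open>d p\<close>.\<close>
  obtain p where p: "p \<in> V" using assms(3) by fastforce
  have "even (pair_sum u T + d p)" if "T \<in> nsets V 3" for T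
  proof -
    from that obtain x y z where "T = {x, y, z}" "x \<in> V" "y \<in> V" "z \<in> V"
      "x \<noteq> y" "y \<noteq> z" "x \<noteq> z" by (rule nsets3_E)
    then have "even ((pair_sum u T + d x + d y + d z) - (d x + d p) - (d y + d p) - (d z + d p))"
      using p by (intro dvd_diff const) (use deg[of x y z] in \<open>auto simp: pair_sum_triple\<close>)
    then have "even (pair_sum u T - 3 * d p)" by (simp add: algebra_simps)
    then show ?thesis by simp
  qed
  then show ?thesis by (cases "even (d p)") auto
qed

section \<open>Sign sums of two graphs\<close>

definition edge_sign :: "'a set set \<Rightarrow> 'a set \<Rightarrow> int" where
  "edge_sign E e = (if e \<in> E then 1 else -1)"

definition square_diff :: "'a set set \<Rightarrow> 'a set set \<Rightarrow> 'a set \<Rightarrow> int" where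
  "square_diff E E' K = (pair_sum (edge_sign E) K)\<^sup>2 - (pair_sum (edge_sign E') K)\<^sup>2"

definition cover_diff :: "'a set set \<Rightarrow> 'a set set \<Rightarrow> 'a set \<Rightarrow> int" where
  "cover_diff E E' S = cover_sum (edge_sign E) S - cover_sum (edge_sign E') S"

lemma pair_sum_edge_sign:
  assumes "finite K"
  shows "pair_sum (edge_sign E) K = 2 * int (card (nsets K 2 \<inter> E)) - int (card K choose 2)"
proof -
  have "pair_sum (edge_sign E) K = (\<Sum>e\<in>nsets K 2. 2 * of_bool (e \<in> E) - 1)"
    unfolding pair_sum_def by (intro sum.cong) (auto simp: edge_sign_def)
  also have "\<dots> = 2 * (\<Sum>e\<in>nsets K 2. of_bool (e \<in> E)) - int (card K choose 2)"
    by (simp add: sum_subtractf sum_distrib_left)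
  also have "(\<Sum>e\<in>nsets K 2. of_bool (e \<in> E)) = int (card (nsets K 2 \<inter> E))"
    using assms by (simp add: finite_imp_finite_nsets)
  finally show ?thesis .
qed

text \<open>Equal squares mean equal or opposite sign sums, and complementing a graph negates its
  sign sum. This turns the edge condition of the theorem into one equation.\<close>

lemma square_diff_eq_0_iff:
  assumes "finite K"
  shows "square_diff E E' K = 0 \<longleftrightarrow> card (nsets K 2 \<inter> E') = card (nsets K 2 \<inter> E) \<or>
    card (nsets K 2 \<inter> E') + card (nsets K 2 \<inter> E) = card K choose 2"
  using assms unfolding square_diff_def pair_sum_edge_sign[OF assms] 
  by (auto simp: power2_eq_iff)

text \<open>The diagonal terms of \<open>pair_sum_square\<close> are 1 for both sign functions and
  cancel.\<close>

lemma square_diff_eq: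
  assumes "finite K"
  shows "square_diff E E' K =
    sum (cover_diff E E') (nsets K 3) + sum (cover_diff E E') (nsets K 4)"
proof -
  have "(edge_sign F e)\<^sup>2 = 1" for F :: "'a set set" and e by (simp add: edge_sign_def)
  then show ?thesis
    using assms by (simp add: square_diff_def cover_diff_def pair_sum_square sum_subtractf)
qed

text \<open>A triple has no 4-subsets, so its term is the full difference of squares. Its sign sum
  is 3 or -3 if it is homogeneous, and 1 or -1 otherwise.\<close>

lemma cover_diff_triple:
  assumes "T \<in> nsets V 3"
  shows "cover_diff E E' T = 8 * (of_bool (homog E T) - of_bool (homog E' T))"
proof -
  from assms obtain x y z where T: "T = {x, y, z}" and d: "x \<noteq> y" "y \<noteq> z" "x \<noteq> z"
    by (rule nsets3_E)
  have sq: "(pair_sum (edge_sign F) T)\<^sup>2 = 1 + 8 * of_bool (homog F T)" for F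
    unfolding T homog_triple[OF d] pair_sum_triple[OF d] by (simp add: edge_sign_def)
  have "finite T" "card T = 3" using assms by (auto simp: nsets_def)
  then have "cover_diff E E' T = square_diff E E' T"
    by (simp add: square_diff_eq nsets_card_self nsets_eq_empty)
  then show ?thesis by (simp add: square_diff_def sq)
qed

lemma sum_cover_diff_triples:
  assumes "finite K"
  shows "sum (cover_diff E E') (nsets K 3) =
    8 * (int (card {T \<in> nsets K 3. homog E T}) - int (card {T \<in> nsets K 3. homog E' T}))"
proof -
  have "sum (cover_diff E E') (nsets K 3) =
      (\<Sum>T\<in>nsets K 3. 8 * (of_bool (homog E T) - of_bool (homog E' T)))"
    by (intro sum.cong refl cover_diff_triple)
  also have "\<dots> = 8 * ((\<Sum>T\<in>nsets K 3. of_bool (homog E T)) - (\<Sum>T\<in>nsets K 3. of_bool (homog E' T)))"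
    by (simp add: sum_subtractf flip: sum_distrib_left)
  finally show ?thesis
    using assms by (simp add: finite_imp_finite_nsets Int_def)
qed

lemma even_sdiff_sum:
  assumes "finite K"
  shows "even (sdiff_sum E E' K) \<longleftrightarrow> even (card (nsets K 2 \<inter> E) + card (nsets K 2 \<inter> E'))"
proof -
  have "sdiff_sum E E' K =
      (\<Sum>e\<in>nsets K 2. of_bool (e \<in> E) + of_bool (e \<in> E') - 2 * of_bool (e \<in> E \<inter> E'))"
    unfolding sdiff_sum_def pair_sum_def by (intro sum.cong) auto
  also have "\<dots> = (\<Sum>e\<in>nsets K 2. of_bool (e \<in> E)) + (\<Sum>e\<in>nsets K 2. of_bool (e \<in> E')) -
      2 * (\<Sum>e\<in>nsets K 2. of_bool (e \<in> E \<inter> E'))"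
    by (simp only: sum.distrib sum_subtractf sum_distrib_left)
  also have "\<dots> = int (card (nsets K 2 \<inter> E)) + int (card (nsets K 2 \<inter> E')) -
      2 * int (card (nsets K 2 \<inter> (E \<inter> E')))"
    using assms by (simp add: finite_imp_finite_nsets Int_def)
  finally show ?thesis by simp
qed

text \<open>With \<open>m\<close> and \<open>n\<close> edges the sign sums are
  \<open>2 * m - 6\<close> and \<open>2 * n - 6\<close>. The witness is
  \<open>(m - n) * (m + n - 6)\<close>, whose factors both have the parity of
  \<open>m + n\<close>.\<close>

lemma square_diff_quadruple:
  assumes "card Q = 4"
  shows "\<exists>q. square_diff E E' Q = 4 * q \<and> (even q \<longleftrightarrow> even (sdiff_sum E E' Q))"
proof (intro exI conjI)
  have fin: "finite Q" using assms by (intro card_ge_0_finite) simp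
  let ?m = "int (card (nsets Q 2 \<inter> E))" and ?n = "int (card (nsets Q 2 \<inter> E'))"
  have "(4::nat) choose 2 = 6" by (simp add: choose_two)
  then show "square_diff E E' Q = 4 * ((?m - ?n) * (?m + ?n - 6))"
    using assms unfolding square_diff_def pair_sum_edge_sign[OF fin]
    by (simp add: power2_eq_square algebra_simps)
  show "even ((?m - ?n) * (?m + ?n - 6)) \<longleftrightarrow> even (sdiff_sum E E' Q)"
    unfolding even_sdiff_sum[OF fin] by simp
qed

section \<open>From (ii) to (iv)\<close>

lemma equal_or_complementary:
  fixes E E' :: "'a set set"
  assumes "finite V" "6 \<le> card V" "4 \<le> k" "k + 2 \<le> card V"
    and cases: "4 dvd k \<or> k + 4 \<le> card V \<or> k + 3 = card V \<and> even (card V)"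
    and sq: "\<And>K. K \<in> nsets V k \<Longrightarrow> square_diff E E' K = 0"
    and hom: "\<And>K. K \<in> nsets V k \<Longrightarrow> sum (cover_diff E E') (nsets K 3) = 0"
  shows "(\<forall>e\<in>nsets V 2. e \<in> E \<longleftrightarrow> e \<in> E') \<or> (\<forall>e\<in>nsets V 2. e \<in> E \<longleftrightarrow> e \<notin> E')"
proof -
  let ?U = "{e. e \<in> E \<longleftrightarrow> e \<notin> E'}"
  have const: ?thesis if "even n" "4 \<le> n" "n + 2 \<le> card V"
    and "\<And>K. K \<in> nsets V n \<Longrightarrow> even (sdiff_sum E E' K)" for n
  proof -
    have "nsets V 2 \<subseteq> ?U \<or> nsets V 2 \<inter> ?U = {}"
      using that assms(1) by (intro constant_if_even_pair_sums[where k = n]) (auto simp: sdiff_sum_def)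
    then show ?thesis by blast
  qed
  show ?thesis
  proof (cases "4 dvd k")
    case True
    show ?thesis
    proof (rule const[where n = k])
      fix K assume K: "K \<in> nsets V k"
      then have fin: "finite K" "card K = k" by (auto simp: nsets_def)
      \<comment> \<open>As \<open>k choose 2\<close> is even, both alternatives for the edge counts
        make their sum even.\<close>
      obtain j where "k = 4 * j" using True by (elim dvdE)
      then have "k choose 2 = 2 * (j * (4 * j - 1))" by (simp add: choose_two)
      then have "even (k choose 2)" by simp
      moreover have "card (nsets K 2 \<inter> E') = card (nsets K 2 \<inter> E) \<or>
          card (nsets K 2 \<inter> E') + card (nsets K 2 \<inter> E) = k choose 2"
        using sq[OF K] fin by (simp add: square_diff_eq_0_iff)
      ultimately have "even (card (nsets K 2 \<inter> E) + card (nsets K 2 \<inter> E'))"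
        by (metis add.commute even_add)
      then show "even (sdiff_sum E E' K)"
        using fin by (simp add: even_sdiff_sum)
    qed (use True assms in auto)
  next
    case False
    then have k3: "k + 3 \<le> card V" using cases by auto
    have zero3: "cover_diff E E' T = 0" if "T \<in> nsets V 3" for T
      using assms k3 that by (intro eq_0_if_nsets_sums_eq_0[where f = "cover_diff E E'" and k = k]) auto
    have sum4: "sum (cover_diff E E') (nsets K 4) = 0" if "K \<in> nsets V k" for K
      using sq[OF that] hom[OF that] square_diff_eq[of K E E'] that by (simp add: nsets_def)
    have quad: "cover_diff E E' Q = square_diff E E' Q" if Q: "Q \<in> nsets V 4" for Q
    proof -
      have "sum (cover_diff E E') (nsets Q 3) = 0"
        using Q by (intro sum.neutral ballI zero3) (auto simp: nsets_def)
      moreover have "finite Q" "card Q = 4" using Q by (auto simp: nsets_def)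
      ultimately show ?thesis by (simp add: square_diff_eq nsets_card_self)
    qed
    show ?thesis
    proof (cases "k + 4 \<le> card V")
      case True
      show ?thesis
      proof (rule const[where n = 4])
        fix Q assume Q: "Q \<in> nsets V 4"
        then have "cover_diff E E' Q = 0"
          using assms True sum4 by (intro eq_0_if_nsets_sums_eq_0[where f = "cover_diff E E'" and k = k]) auto
        moreover obtain q where "square_diff E E' Q = 4 * q" "even q \<longleftrightarrow> even (sdiff_sum E E' Q)"
          using square_diff_quadruple[of Q E E'] Q by (auto simp: nsets_def)
        ultimately show "even (sdiff_sum E E' Q)" using quad[OF Q] by simp
      qed (use assms in auto)
    next
      case False
      then have v: "even (card V)" using \<open>\<not> 4 dvd k\<close> cases by auto
      have homog: "homog E T \<longleftrightarrow> homog E' T" if "T \<in> nsets V 3" for T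
        using zero3[OF that] cover_diff_triple[OF that, of E E'] by (auto split: if_splits)
      have "even (\<Sum>r\<in>V - T. sdiff_sum E E' (insert r T))" if T: "T \<in> nsets V 3" for T
      proof -
        have T': "T \<subseteq> V" "finite T" "card T = 3" using T by (auto simp: nsets_def)
        have "{Q \<in> nsets V 4. T \<subseteq> Q} = (\<lambda>r. insert r T) ` (V - T)"
        proof (intro equalityI subsetI)
          fix Q assume Q: "Q \<in> {Q \<in> nsets V 4. T \<subseteq> Q}"
          then have "card (Q - T) = 1" using T' by (auto simp: nsets_def card_Diff_subset)
          then obtain r where "Q - T = {r}" by (auto simp: card_1_singleton_iff)
          then show "Q \<in> (\<lambda>r. insert r T) ` (V - T)"
            using Q by (intro image_eqI[where x = r]) (auto simp: nsets_def)
        qed (use T' in \<open>auto simp: nsets_def\<close>)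
        moreover have "inj_on (\<lambda>r. insert r T) (V - T)" by (auto simp: inj_on_def)
        \<comment> \<open>There is no longer room to isolate a single 4-set, but
          \<open>k + 3 \<le> card V\<close> suffices for the sum over all 4-sets containing a
          triple.\<close>
        moreover have "sum (cover_diff E E') {Q \<in> nsets V 4. T \<subseteq> Q} = 0"
          using assms k3 T' sum4 by (intro sum_supersets_eq_0[where k = k]) auto
        ultimately have "(\<Sum>r\<in>V - T. cover_diff E E' (insert r T)) = 0"
          by (simp add: sum.reindex)
        moreover have Q: "insert r T \<in> nsets V 4" if "r \<in> V - T" for r
          using that T' by (auto simp: nsets_def)
        ultimately have "(\<Sum>r\<in>V - T. square_diff E E' (insert r T)) = 0"
          by (simp add: quad)
        moreover have "\<forall>r\<in>V - T. \<exists>q. square_diff E E' (insert r T) = 4 * q \<and>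
            (even q \<longleftrightarrow> even (sdiff_sum E E' (insert r T)))"
          using T' by (intro ballI square_diff_quadruple) auto
        then obtain q where q: "\<And>r. r \<in> V - T \<Longrightarrow> square_diff E E' (insert r T) = 4 * q r"
            "\<And>r. r \<in> V - T \<Longrightarrow> even (q r) \<longleftrightarrow> even (sdiff_sum E E' (insert r T))"
          by metis
        ultimately have "(\<Sum>r\<in>V - T. q r) = 0"
          by (simp flip: sum_distrib_left)
        moreover have "even ((\<Sum>r\<in>V - T. sdiff_sum E E' (insert r T)) - (\<Sum>r\<in>V - T. q r))"
          unfolding sum_subtractf[symmetric] using q(2) by (intro dvd_sum) auto
        ultimately show ?thesis by simp
      qed
      then have "(\<forall>T\<in>nsets V 3. even (sdiff_sum E E' T)) \<or> (\<forall>T\<in>nsets V 3. odd (sdiff_sum E E' T))"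
        unfolding sdiff_sum_def using assms v by (intro equal_parity_triples) auto
      then show ?thesis
      proof
        assume "\<forall>T\<in>nsets V 3. even (sdiff_sum E E' T)"
        then have "e \<in> E \<longleftrightarrow> e \<in> E'" if "e \<in> nsets V 2" for e
          using assms(2) homog that by (intro eq_if_even_triples[where V = V]) auto
        then show ?thesis by blast
      next
        assume odd: "\<forall>T\<in>nsets V 3. odd (sdiff_sum E E' T)"
        \<comment> \<open>Complementing \<open>E'\<close> flips the membership of all three pairs in
          the symmetric difference, and three is odd.\<close>
        have "even (sdiff_sum E (- E') T)" if "T \<in> nsets V 3" for T
        proof -
          from that obtain x y z where "T = {x, y, z}" "x \<noteq> y" "y \<noteq> z" "x \<noteq> z"
            by (rule nsets3_E)
          then show ?thesis
            using odd that sdiff_sum_triple[of x y z E E'] sdiff_sum_triple[of x y z E "- E'"] by auto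
        qed
        moreover have "homog (- E') T \<longleftrightarrow> homog E' T" for T by (auto simp: homog_def)
        ultimately have "e \<in> E \<longleftrightarrow> e \<in> - E'" if "e \<in> nsets V 2" for e
          using assms(2) homog that by (intro eq_if_even_triples[where V = V]) auto
        then show ?thesis by blast
      qed
    qed
  qed
qed

section \<open>From (iii) to (ii)\<close>

text \<open>Used with (iii)'s \<open>k'\<close> as \<open>k\<close>. \<open>L\<close> itself gives
  triple sum plus 4-set sum equal to 0; averaging over \<open>k\<close>-subsets gives a second
  linear relation. By Pascal's rule the determinant is, up to sign,
  \<open>(card L - 4) choose (k - 3)\<close>, nonzero as \<open>k < card L\<close>.\<close>

lemma cover_diff_sums_eq_0:
  assumes "finite L" "3 \<le> k" "k < card L"
    and "square_diff E E' L = 0" "\<And>K. K \<in> nsets L k \<Longrightarrow> square_diff E E' K = 0"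
  shows "sum (cover_diff E E') (nsets L 3) = 0"
proof -
  let ?s = "\<lambda>n. sum (cover_diff E E') (nsets L n)"
  \<comment> \<open>For \<open>k = 3\<close> there are no 4-subsets, while truncated
    \<open>k - 4\<close> would give coefficient 1.\<close>
  have four: "(\<Sum>K\<in>nsets L k. sum (cover_diff E E') (nsets K 4)) =
      int (if k = 3 then 0 else (card L - 4) choose (k - 4)) * ?s 4"
  proof (cases "k = 3")
    case True
    then have "nsets K 4 = {}" if "K \<in> nsets L k" for K
      using that by (auto simp: nsets_def dest: card_mono)
    then show ?thesis using True by simp
  next
    case False
    then show ?thesis using assms by (simp add: sum_nsets_nsets)
  qed
  have "(\<Sum>K\<in>nsets L k. square_diff E E' K) = 0" using assms by simp
  moreover have "(\<Sum>K\<in>nsets L k. square_diff E E' K) =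
      (\<Sum>K\<in>nsets L k. sum (cover_diff E E') (nsets K 3) + sum (cover_diff E E') (nsets K 4))"
    by (intro sum.cong square_diff_eq) (auto simp: nsets_def)
  ultimately have "int ((card L - 3) choose (k - 3)) * ?s 3 +
      int (if k = 3 then 0 else (card L - 4) choose (k - 4)) * ?s 4 = 0"
    using assms four by (simp add: sum.distrib sum_nsets_nsets)
  moreover have "?s 4 = - ?s 3"
    using assms square_diff_eq[of L E E'] by simp
  moreover have "(card L - 3) choose (k - 3) =
      ((card L - 4) choose (k - 3)) + (if k = 3 then 0 else (card L - 4) choose (k - 4))"
  proof (cases "k = 3")
    case False
    have "card L - 3 = Suc (card L - 4)" "k - 3 = Suc (k - 4)" using assms False by auto
    then show ?thesis using False by simp
  qed simp
  ultimately have "int ((card L - 4) choose (k - 3)) * ?s 3 = 0"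
    by (simp add: algebra_simps split: if_splits)
  moreover have "(card L - 4) choose (k - 3) \<noteq> 0" using assms by simp
  ultimately show ?thesis by simp
qed

section \<open>Edge counts, homogeneous triples and isomorphism of graphs\<close>

lemma num_edges_induced:
  assumes "is_graph G" "K \<subseteq> verts G"
  shows "num_edges (induced G K) = card (nsets K 2 \<inter> edges G)"
  unfolding num_edges_def induced_def using assms
  by (intro arg_cong[where f = card]) (auto simp: is_graph_def nsets_def)

lemma is_graph_compl_graph: "is_graph (compl_graph G)"
  by (simp add: is_graph_def compl_graph_def)

lemma compl_graph_compl_graph:
  assumes "is_graph G"
  shows "compl_graph (compl_graph G) = G"
  using assms by (cases G) (auto simp: compl_graph_def is_graph_def)

lemma is_graph_induced:
  assumes "is_graph G"
  shows "is_graph (induced G K)"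
  using assms by (auto simp: is_graph_def induced_def nsets_def)

lemma compl_graph_induced:
  assumes "K \<subseteq> verts G"
  shows "compl_graph (induced G K) = induced (compl_graph G) K"
  using assms by (auto simp: compl_graph_def induced_def nsets_def)

lemma num_edges_compl_graph:
  assumes "is_graph H" "finite (verts H)"
  shows "num_edges H + num_edges (compl_graph H) = card (verts H) choose 2"
proof -
  have fin: "finite (edges H)"
    using assms by (auto simp: is_graph_def intro: finite_subset finite_imp_finite_nsets)
  then have "num_edges (compl_graph H) = (card (verts H) choose 2) - num_edges H"
    using assms by (simp add: num_edges_def compl_graph_def is_graph_def card_Diff_subset)
  moreover have "num_edges H \<le> card (verts H) choose 2"
    using assms card_mono[of "nsets (verts H) 2" "edges H"]
    by (simp add: num_edges_def is_graph_def finite_imp_finite_nsets)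
  ultimately show ?thesis by simp
qed

lemma homogeneous3_eq: "homogeneous3 G = {T \<in> nsets (verts G) 3. homog (edges G) T}"
  by (simp add: homogeneous3_def homog_def)

lemma h3_compl_graph: "h3 (compl_graph H) = h3 H"
proof -
  have "homog (edges (compl_graph H)) T \<longleftrightarrow> homog (edges H) T" if "T \<in> nsets (verts H) 3" for T
  proof -
    have "nsets T 2 \<subseteq> nsets (verts H) 2" using that by (auto simp: nsets_def)
    then show ?thesis by (auto simp: homog_def compl_graph_def)
  qed
  moreover have "verts (compl_graph H) = verts H" by (simp add: compl_graph_def)
  ultimately show ?thesis by (simp add: h3_def homogeneous3_eq cong: conj_cong)
qed

lemma h3_induced:
  "h3 (induced G K) = card {T \<in> nsets K 3. homog (edges G) T}"
proof -
  have "homog (edges (induced G K)) T \<longleftrightarrow> homog (edges G) T" if "T \<in> nsets K 3" for T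
  proof -
    have "nsets T 2 \<subseteq> Pow K" using that by (auto simp: nsets_def)
    then show ?thesis unfolding homog_def induced_def snd_conv by blast
  qed
  moreover have "verts (induced G K) = K" by (simp add: induced_def)
  ultimately show ?thesis by (simp add: h3_def homogeneous3_eq cong: conj_cong)
qed

lemma isomorphic_refl: "isomorphic G G"
  unfolding isomorphic_def by (intro exI[of _ id]) simp

lemma isomorphic_invariants:
  assumes "isomorphic G H" "is_graph G" "is_graph H"
  shows "num_edges G = num_edges H" and "h3 G = h3 H"
proof -
  obtain f where f: "bij_betw f (verts G) (verts H)"
    and adj: "\<And>x y. x \<in> verts G \<Longrightarrow> y \<in> verts G \<Longrightarrow> {x, y} \<in> edges G \<longleftrightarrow> {f x, f y} \<in> edges H"
    using assms(1) by (auto simp: isomorphic_def)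
  have edge: "f ` e \<in> edges H \<longleftrightarrow> e \<in> edges G" if e: "e \<in> nsets (verts G) 2" for e
    using e adj by (elim nsets2_E) auto
  have bij: "bij_betw (\<lambda>X. f ` X) (nsets (verts G) n) (nsets (verts H) n)" for n
    using f by (rule bij_betw_nsets)
  have "bij_betw (\<lambda>X. f ` X) {e \<in> nsets (verts G) 2. e \<in> edges G} {e \<in> nsets (verts H) 2. e \<in> edges H}"
    by (rule bij_betw_Collect[OF bij]) (simp add: edge)
  moreover have "{e \<in> nsets (verts F) 2. e \<in> edges F} = edges F" if "is_graph F" for F :: "'c graph"
    using that by (auto simp: is_graph_def)
  ultimately show "num_edges G = num_edges H"
    using assms by (auto simp: num_edges_def is_graph_def Int_absorb1 Collect_conj_eq dest: bij_betw_same_card)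
  \<comment> \<open>Taking images under \<open>f\<close> maps the pairs in \<open>T\<close> onto the
    pairs in its image and respects edges.\<close>
  have "homog (edges H) (f ` T) \<longleftrightarrow> homog (edges G) T" if T: "T \<in> nsets (verts G) 3" for T
  proof -
    have "T \<subseteq> verts G" using T by (simp add: nsets_def)
    then have "inj_on f T" "nsets T 2 \<subseteq> nsets (verts G) 2"
      using f by (auto simp: bij_betw_def nsets_def intro: inj_on_subset)
    then have "nsets (f ` T) 2 = (\<lambda>e. f ` e) ` nsets T 2"
      using bij_betw_nsets[of f T "f ` T" 2] by (simp add: bij_betw_def)
    moreover have "\<forall>e\<in>nsets T 2. f ` e \<in> edges H \<longleftrightarrow> e \<in> edges G"
      using edge \<open>nsets T 2 \<subseteq> nsets (verts G) 2\<close> by blast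
    ultimately show ?thesis
      unfolding homog_def by (simp add: image_subset_iff subset_iff disjoint_iff) blast
  qed
  then have "bij_betw (\<lambda>X. f ` X) (homogeneous3 G) (homogeneous3 H)"
    unfolding homogeneous3_eq by (intro bij_betw_Collect[OF bij]) auto
  then show "h3 G = h3 H"
    unfolding h3_def by (rule bij_betw_same_card)
qed

section \<open>The four equivalent conditions\<close>

theorem theorem3p1:
  fixes v k :: nat and V :: "'a set" and G G' :: "'a graph"
  assumes "v \<ge> 6" and "4 \<le> k" and "int k \<le> vartheta v"
    and "card V = v"
    and "is_graph G" and "verts G = V"
    and "is_graph G'" and "verts G' = V"
  shows
    "(hypomorphic_upto_compl k V G G'
      \<longleftrightarrow> (\<forall>K \<in> nsets V k.
            num_edges (induced G' K)
              \<in> {num_edges (induced G K), num_edges (induced (compl_graph G) K)} \<and>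
            h3 (induced G K) = h3 (induced G' K)))
   \<and> ((\<forall>K \<in> nsets V k.
            num_edges (induced G' K)
              \<in> {num_edges (induced G K), num_edges (induced (compl_graph G) K)} \<and>
            h3 (induced G K) = h3 (induced G' K))
      \<longleftrightarrow> (\<exists>k'. 3 \<le> k' \<and> k' < k \<and>
            (\<forall>K. K \<subseteq> V \<and> card K \<in> {k, k'} \<longrightarrow>
              num_edges (induced G' K)
                \<in> {num_edges (induced G K), num_edges (induced (compl_graph G) K)})))
   \<and> ((\<exists>k'. 3 \<le> k' \<and> k' < k \<and>
            (\<forall>K. K \<subseteq> V \<and> card K \<in> {k, k'} \<longrightarrow>
              num_edges (induced G' K)
                \<in> {num_edges (induced G K), num_edges (induced (compl_graph G) K)}))
      \<longleftrightarrow> (G' = G \<or> G' = compl_graph G))"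
proof -
  let ?E = "edges G" and ?E' = "edges G'"
  let ?e = "\<lambda>K. num_edges (induced G' K)
    \<in> {num_edges (induced G K), num_edges (induced (compl_graph G) K)}"
  let ?ii = "\<forall>K\<in>nsets V k. ?e K \<and> h3 (induced G K) = h3 (induced G' K)"
  let ?iii = "\<exists>k'. 3 \<le> k' \<and> k' < k \<and> (\<forall>K. K \<subseteq> V \<and> card K \<in> {k, k'} \<longrightarrow> ?e K)"
  let ?iv = "G' = G \<or> G' = compl_graph G"
  have fin: "finite V" using assms(1,4) by (intro card_ge_0_finite) simp
  have edges_compl: "num_edges (induced G K) + num_edges (induced (compl_graph G) K) = card K choose 2"
    if "K \<subseteq> V" for K
    using num_edges_compl_graph[of "induced G K"] compl_graph_induced[of K G] is_graph_induced[of G K]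
      assms that fin by (auto simp: induced_def intro: finite_subset)
  have e_iff: "?e K \<longleftrightarrow> square_diff ?E ?E' K = 0" if "K \<subseteq> V" for K
    using edges_compl[OF that] that assms fin
    by (auto simp: square_diff_eq_0_iff num_edges_induced finite_subset)
  have subset: "K \<subseteq> V" "finite K" "card K = k" if "K \<in> nsets V k" for K k
    using that by (auto simp: nsets_def)

  have i_ii: ?ii if hyp: "hypomorphic_upto_compl k V G G'"
  proof
    fix K assume K: "K \<in> nsets V k"
    then have KV: "K \<subseteq> V" by (rule subset)
    have gr: "is_graph (induced G K)" "is_graph (induced G' K)" using assms by (auto intro: is_graph_induced)
    have "isomorphic (induced G K) (induced G' K) \<or>
        isomorphic (induced G K) (compl_graph (induced G' K))"
      using hyp K by (auto simp: hypomorphic_upto_compl_def iso_upto_compl_def)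
    then show "?e K \<and> h3 (induced G K) = h3 (induced G' K)"
    proof
      assume "isomorphic (induced G K) (induced G' K)"
      from isomorphic_invariants[OF this gr] show ?thesis by simp
    next
      assume iso: "isomorphic (induced G K) (compl_graph (induced G' K))"
      \<comment> \<open>The isomorphism complements \<open>G'\<close>, the edge condition
        complements \<open>G\<close>; subtraction from \<open>card K choose 2\<close> reconciles
        them.\<close>
      have "num_edges (induced G' K) + num_edges (compl_graph (induced G' K)) = card K choose 2"
        using num_edges_compl_graph[OF gr(2)] subset(2)[OF K] by (simp add: induced_def)
      then show ?thesis
        using isomorphic_invariants[OF iso gr(1) is_graph_compl_graph] edges_compl[OF KV]
        by (simp add: h3_compl_graph)
    qed
  qed

  have ii_iv: ?iv if ii: ?ii
  proof -
    obtain l r where v: "v = 4 * l + r" "r < 4" "v div 4 = l" "v mod 4 = r"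
      by (metis div_mult_mod_eq mod_less_divisor mult.commute zero_less_numeral)
    have bound: "int k \<le> (if r \<in> {2, 3} then 4 * int l else 4 * int l - 3)"
      using assms(3) v(3,4) by (simp only: vartheta_def)
    consider "r = 0 \<or> r = 1" "k + 3 \<le> 4 * l" | "r = 2 \<or> r = 3" "k \<le> 4 * l"
    proof (cases "r \<in> {2, 3}")
      case True
      then show ?thesis using bound that(2) by simp
    next
      case False
      then have "r = 0 \<or> r = 1" using v(2) by auto
      moreover have "k + 3 \<le> 4 * l" using False bound by simp
      ultimately show ?thesis by (rule that(1))
    qed
    \<comment> \<open>For \<open>r \<le> 1\<close>, \<open>k + 4 \<le> v\<close> fails only if
      \<open>r = 0\<close> and \<open>k = v - 3\<close>. For \<open>r \<ge> 2\<close>, either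
      \<open>k = 4 * l\<close>, or \<open>k + 4 \<le> v\<close> fails only if \<open>r = 2\<close>
      and \<open>k = v - 3\<close>. In both exceptions \<open>v\<close> is even.\<close>
    then have range: "k + 2 \<le> v \<and> (4 dvd k \<or> k + 4 \<le> v \<or> k + 3 = v \<and> even v)"
    proof cases
      case 2
      then show ?thesis using v(1) by (cases "k = 4 * l") auto
    qed (use v(1) in auto)
    have "(\<forall>e\<in>nsets V 2. e \<in> ?E \<longleftrightarrow> e \<in> ?E') \<or> (\<forall>e\<in>nsets V 2. e \<in> ?E \<longleftrightarrow> e \<notin> ?E')"
    proof (rule equal_or_complementary[where k = k])
      fix K assume K: "K \<in> nsets V k"
      show "square_diff ?E ?E' K = 0" using ii K e_iff subset(1)[OF K] by blast
      show "sum (cover_diff ?E ?E') (nsets K 3) = 0"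
        using ii K subset(2)[OF K] by (simp add: sum_cover_diff_triples flip: h3_induced)
    qed (use assms fin range in auto)
    moreover have "?E \<subseteq> nsets V 2" "?E' \<subseteq> nsets V 2"
      using assms by (auto simp: is_graph_def)
    ultimately have "?E' = ?E \<or> ?E' = nsets V 2 - ?E" by blast
    then show ?thesis
      using assms(6,8) by (simp add: prod_eq_iff compl_graph_def)
  qed

  have iii_ii: ?ii if ?iii
  proof
    fix K assume K: "K \<in> nsets V k"
    from \<open>?iii\<close> obtain k' where k': "3 \<le> k'" "k' < k"
      and e: "\<forall>L. L \<subseteq> V \<and> card L \<in> {k, k'} \<longrightarrow> ?e L"
      by (elim exE conjE)
    have sq: "square_diff ?E ?E' L = 0" if "L \<subseteq> V" "card L \<in> {k, k'}" for L
      using e that by (simp only: e_iff[symmetric])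
    have "sum (cover_diff ?E ?E') (nsets K 3) = 0"
      using K k' sq by (intro cover_diff_sums_eq_0[where k = k']) (auto simp: nsets_def)
    then have "h3 (induced G K) = h3 (induced G' K)"
      using subset(2)[OF K] by (simp add: sum_cover_diff_triples h3_induced)
    then show "?e K \<and> h3 (induced G K) = h3 (induced G' K)"
      using e subset[OF K] by simp
  qed

  have iv_i: "hypomorphic_upto_compl k V G G'" if ?iv
    unfolding hypomorphic_upto_compl_def
  proof
    fix K assume "K \<in> nsets V k"
    then have K: "K \<subseteq> V" by (rule subset)
    from \<open>?iv\<close> show "iso_upto_compl (induced G K) (induced G' K)"
    proof
      assume "G' = compl_graph G"
      then have "compl_graph (induced G' K) = induced G K"
        using K assms by (simp add: compl_graph_compl_graph is_graph_induced flip: compl_graph_induced)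
      then show ?thesis by (simp add: iso_upto_compl_def isomorphic_refl)
    qed (simp add: iso_upto_compl_def isomorphic_refl)
  qed

  have iv_iii: ?iii if ?iv
    using that assms(2) by (intro exI[of _ 3]) auto

  \<comment> \<open>The cycle (i), (ii), (iv), (i) is joined to (iii) by (iv) to (iii) and (iii) to
    (ii).\<close>
  show ?thesis using i_ii ii_iv iii_ii iv_i iv_iii by blast
qed

end
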